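(* Let $P:\mathbb C^{\mathrm{op}}\to\mathbf{Pos}$ be a primary doctrine, $X$ an object of $\mathbb C$ and $\varphi\in P(X)$, and let $P_{(X,\varphi)}$ be the associated Kleisli doctrine with canonical 1-arrow $(F_X,\mathfrak f):P\to P_{(X,\varphi)}$. If $P$ is an existential doctrine, then $P_{(X,\varphi)}$ is an existential doctrine, and $(F_X,\mathfrak f)$ is an existential homomorphism.
   Context: A doctrine is a functor $P:\mathbb C^{\mathrm{op}}\to\mathbf{Pos}$ with $\mathbb C$ a category with finite products and $\mathbf{Pos}$ the category of posets and monotone maps; the maps $P(f)$ are called reindexings. It is primary if every $P(A)$ has finite meets ($\wedge$, $\top$) and all reindexings preserve them. A 1-arrow (doctrine homomorphism) from $P:\mathbb C^{\mathrm{op}}\to\mathbf{Pos}$ to $R:\mathbb D^{\mathrm{op}}\to\mathbf{Pos}$ is a pair $(F,\mathfrak f)$ with $F:\mathbb C\to\mathbb D$ a finite-product-preserving functor and $\mathfrak f:P\to R\circ F^{\mathrm{op}}$ natural; it is primary if $P,R$ are primary and each $\mathfrak f_A$ preserves finite meets. A primary doctrine $P$ is existential if for all objects $B,C$ the map $P(\mathrm{pr}_1):P(C)\to P(C\times B)$ has a left adjoint $\exists^B_C:P(C\times B)\to P(C)$ satisfying Beck–Chevalley: $\exists^B_CP(f\times\mathrm{id}_B)=P(f)\exists^B_{C'}$ for every $f:C\to C'$; and Frobenius reciprocity: $\exists^B_C(\alpha\wedge P(\mathrm{pr}_1)(\beta))=\exists^B_C(\alpha)\wedge\beta$ for all $\alpha\in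 P(C\times B)$, $\beta\in P(C)$. A primary homomorphism $(F,\mathfrak f)$ between existential doctrines is existential if $\mathfrak f_C\exists^B_C=\exists^{FB}_{FC}\mathfrak f_{C\times B}$ for all $B,C$. Kleisli doctrine (the Kleisli object of the comonad on $P$ given by $X\times-$ and $\alpha\mapsto P(\mathrm{pr}_1)(\varphi)\wedge P(\mathrm{pr}_2)(\alpha)$). The category $\mathbb C_X$ has the same objects as $\mathbb C$; an arrow $g:A\rightsquigarrow B$ in $\mathbb C_X$ is a $\mathbb C$-arrow $g:X\times A\to B$; the identity of $A$ is $\mathrm{pr}_2:X\times A\to A$; the composite of $g:A\rightsquigarrow B$ and $h:B\rightsquigarrow C$ is $h\langle\mathrm{pr}_1,g\rangle$. It has finite products, given on objects by those of $\mathbb C$. The doctrine $P_{(X,\varphi)}:\mathbb C_X^{\mathrm{op}}\to\mathbf{Pos}$ has $P_{(X,\varphi)}(A)=\{\alpha\in P(X\times A)\mid\alpha\le P(\mathrm{pr}_1)(\varphi)\}$ with the order of $P(X\times A)$, and reindexing along $g:A\rightsquigarrow B$ is the restriction of $P(\langle\mathrm{pr}_1,g\rangle)$. The 1-arrow $(F_X,\mathfrak f):P\to P_{(X,\varphi)}$: $F_X:\mathbb C\to\mathbb C_X$ is the identity on objects and sends $f:A\to B$ to $f\,\mathrm{pr}_2:A\rightsquigarrow B$; $\mathfrak f_A(\alpha)=P(\mathrm{pr}_1)(\varphi)\wedge P(\mathrm{pr}_2)(\alpha)$, for $\mathrm{pr}_1,\mathrm{pr}_2$ the projections from $X\times A$.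 *)

theory Defs
  imports "HOL-Algebra.Galois_Connection"
begin

section \<open>Categories with finite products\<close>

text \<open>
  Categories are given by families of hom-sets, which need not be disjoint; composition is
  therefore indexed by the objects involved, and \<open>Comp C A B D g f\<close> is the composite of
  \<open>f : A \<rightarrow> B\<close> and \<open>g : B \<rightarrow> D\<close>.  In this way an arrow of a Kleisli category is literally an
  arrow of the original category, even if \<open>A \<mapsto> X \<times> A\<close> is not injective on objects.
  A category with finite products carries a chosen terminal object and chosen binary products.
\<close>

record ('o, 'a) fp_category =
  Ob :: "'o set"
  Hom :: "'o \<Rightarrow> 'o \<Rightarrow> 'a set"
  Id :: "'o \<Rightarrow> 'a"
  Comp :: "'o \<Rightarrow> 'o \<Rightarrow> 'o \<Rightarrow> 'a \<Rightarrow> 'a \<Rightarrow> 'a"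
  One :: "'o"
  Prod :: "'o \<Rightarrow> 'o \<Rightarrow> 'o"  (infixr \<open>\<^bold>\<times>\<index>\<close> 80)
  Pr1 :: "'o \<Rightarrow> 'o \<Rightarrow> 'a"
  Pr2 :: "'o \<Rightarrow> 'o \<Rightarrow> 'a"

locale category =
  fixes C :: "('o, 'a) fp_category" (structure)
  assumes id_in_hom: "A \<in> Ob C \<Longrightarrow> Id C A \<in> Hom C A A"
    and comp_in_hom:
      "\<lbrakk>A \<in> Ob C; B \<in> Ob C; D \<in> Ob C; f \<in> Hom C A B; g \<in> Hom C B D\<rbrakk>
        \<Longrightarrow> Comp C A B D g f \<in> Hom C A D"
    and comp_id_right:
      "\<lbrakk>A \<in> Ob C; B \<in> Ob C; f \<in> Hom C A B\<rbrakk> \<Longrightarrow> Comp C A A B f (Id C A) = f"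
    and comp_id_left:
      "\<lbrakk>A \<in> Ob C; B \<in> Ob C; f \<in> Hom C A B\<rbrakk> \<Longrightarrow> Comp C A B B (Id C B) f = f"
    and comp_assoc:
      "\<lbrakk>A \<in> Ob C; B \<in> Ob C; D \<in> Ob C; E \<in> Ob C;
        f \<in> Hom C A B; g \<in> Hom C B D; h \<in> Hom C D E\<rbrakk>
        \<Longrightarrow> Comp C A D E h (Comp C A B D g f) = Comp C A B E (Comp C B D E h g) f"

definition is_terminal :: "('o, 'a) fp_category \<Rightarrow> 'o \<Rightarrow> bool" where
  "is_terminal C T \<longleftrightarrow> T \<in> Ob C \<and> (\<forall>A\<in>Ob C. \<exists>!f. f \<in> Hom C A T)"

definition is_product :: "('o, 'a) fp_category \<Rightarrow> 'o \<Rightarrow> 'o \<Rightarrow> 'o \<Rightarrow> 'a \<Rightarrow> 'a \<Rightarrow> bool" where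
  "is_product C A B Q p q \<longleftrightarrow>
     Q \<in> Ob C \<and> p \<in> Hom C Q A \<and> q \<in> Hom C Q B \<and>
     (\<forall>Z\<in>Ob C. \<forall>f\<in>Hom C Z A. \<forall>g\<in>Hom C Z B.
        \<exists>!h. h \<in> Hom C Z Q \<and> Comp C Z Q A p h = f \<and> Comp C Z Q B q h = g)"

locale cartesian_category = category +
  assumes one_terminal: "is_terminal C (One C)"
    and prod_product:
      "\<lbrakk>A \<in> Ob C; B \<in> Ob C\<rbrakk> \<Longrightarrow> is_product C A B (A \<^bold>\<times> B) (Pr1 C A B) (Pr2 C A B)"

text \<open>\<open>pair C Z A B f g\<close> is \<open>\<langle>f, g\<rangle> : Z \<rightarrow> A \<times> B\<close>, and \<open>cross C A A' B B' f g\<close> is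
  \<open>f \<times> g : A \<times> B \<rightarrow> A' \<times> B'\<close>.\<close>

definition pair :: "('o, 'a) fp_category \<Rightarrow> 'o \<Rightarrow> 'o \<Rightarrow> 'o \<Rightarrow> 'a \<Rightarrow> 'a \<Rightarrow> 'a" where
  "pair C Z A B f g =
     (THE h. h \<in> Hom C Z (A \<^bold>\<times>\<^bsub>C\<^esub> B) \<and>
        Comp C Z (A \<^bold>\<times>\<^bsub>C\<^esub> B) A (Pr1 C A B) h = f \<and>
        Comp C Z (A \<^bold>\<times>\<^bsub>C\<^esub> B) B (Pr2 C A B) h = g)"

definition cross ::
  "('o, 'a) fp_category \<Rightarrow> 'o \<Rightarrow> 'o \<Rightarrow> 'o \<Rightarrow> 'o \<Rightarrow> 'a \<Rightarrow> 'a \<Rightarrow> 'a" where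
  "cross C A A' B B' f g =
     pair C (A \<^bold>\<times>\<^bsub>C\<^esub> B) A' B'
       (Comp C (A \<^bold>\<times>\<^bsub>C\<^esub> B) A A' f (Pr1 C A B))
       (Comp C (A \<^bold>\<times>\<^bsub>C\<^esub> B) B B' g (Pr2 C A B))"

record ('o, 'a, 'o2, 'a2) func =
  FOb :: "'o \<Rightarrow> 'o2"
  FAr :: "'o \<Rightarrow> 'o \<Rightarrow> 'a \<Rightarrow> 'a2"

locale product_preserving_functor =
  C: cartesian_category C + D: cartesian_category D
  for C :: "('o, 'a) fp_category" and D :: "('o2, 'a2) fp_category" +
  fixes F :: "('o, 'a, 'o2, 'a2) func"
  assumes ob: "A \<in> Ob C \<Longrightarrow> FOb F A \<in> Ob D"
    and ar: "\<lbrakk>A \<in> Ob C; B \<in> Ob C; f \<in> Hom C A B\<rbrakk> \<Longrightarrow> FAr F A B f \<in> Hom D (FOb F A) (FOb F B)"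
    and pres_id: "A \<in> Ob C \<Longrightarrow> FAr F A A (Id C A) = Id D (FOb F A)"
    and pres_comp:
      "\<lbrakk>A \<in> Ob C; B \<in> Ob C; E \<in> Ob C; f \<in> Hom C A B; g \<in> Hom C B E\<rbrakk>
        \<Longrightarrow> FAr F A E (Comp C A B E g f)
            = Comp D (FOb F A) (FOb F B) (FOb F E) (FAr F B E g) (FAr F A B f)"
    and pres_terminal: "is_terminal C T \<Longrightarrow> is_terminal D (FOb F T)"
    and pres_product:
      "\<lbrakk>A \<in> Ob C; B \<in> Ob C; is_product C A B Q p q\<rbrakk>
        \<Longrightarrow> is_product D (FOb F A) (FOb F B) (FOb F Q) (FAr F Q A p) (FAr F Q B q)"

text \<open>The canonical isomorphism \<open>F A \<times> F B \<rightarrow> F (A \<times> B)\<close>.\<close>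

definition prod_iso ::
  "('o, 'a) fp_category \<Rightarrow> ('o2, 'a2) fp_category \<Rightarrow> ('o, 'a, 'o2, 'a2) func
    \<Rightarrow> 'o \<Rightarrow> 'o \<Rightarrow> 'a2" where
  "prod_iso C D F A B =
     (let Q = FOb F A \<^bold>\<times>\<^bsub>D\<^esub> FOb F B; R = FOb F (A \<^bold>\<times>\<^bsub>C\<^esub> B) in
      THE c. c \<in> Hom D Q R \<and>
        Comp D Q R (FOb F A) (FAr F (A \<^bold>\<times>\<^bsub>C\<^esub> B) A (Pr1 C A B)) c
          = Pr1 D (FOb F A) (FOb F B) \<and>
        Comp D Q R (FOb F B) (FAr F (A \<^bold>\<times>\<^bsub>C\<^esub> B) B (Pr2 C A B)) c
          = Pr2 D (FOb F A) (FOb F B))"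


section \<open>Doctrines\<close>

text \<open>\<open>Reidx P A B f\<close> is the reindexing \<open>P(f) : P(B) \<rightarrow> P(A)\<close> along \<open>f : A \<rightarrow> B\<close>.\<close>

record ('o, 'a, 'p) doctrine =
  Base :: "('o, 'a) fp_category"
  Fib :: "'o \<Rightarrow> 'p gorder"
  Reidx :: "'o \<Rightarrow> 'o \<Rightarrow> 'a \<Rightarrow> 'p \<Rightarrow> 'p"

definition monotone_map :: "'p gorder \<Rightarrow> 'q gorder \<Rightarrow> ('p \<Rightarrow> 'q) \<Rightarrow> bool" where
  "monotone_map L M f \<longleftrightarrow> f \<in> carrier L \<rightarrow> carrier M \<and> isotone L M f"

locale is_doctrine =
  fixes P :: "('o, 'a, 'p) doctrine"
  assumes base: "cartesian_category (Base P)"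
    and fib: "A \<in> Ob (Base P) \<Longrightarrow> partial_order (Fib P A)"
    and reidx:
      "\<lbrakk>A \<in> Ob (Base P); B \<in> Ob (Base P); f \<in> Hom (Base P) A B\<rbrakk>
        \<Longrightarrow> monotone_map (Fib P B) (Fib P A) (Reidx P A B f)"
    and reidx_id:
      "\<lbrakk>A \<in> Ob (Base P); \<alpha> \<in> carrier (Fib P A)\<rbrakk> \<Longrightarrow> Reidx P A A (Id (Base P) A) \<alpha> = \<alpha>"
    and reidx_comp:
      "\<lbrakk>A \<in> Ob (Base P); B \<in> Ob (Base P); D \<in> Ob (Base P);
        f \<in> Hom (Base P) A B; g \<in> Hom (Base P) B D; \<alpha> \<in> carrier (Fib P D)\<rbrakk>
        \<Longrightarrow> Reidx P A D (Comp (Base P) A B D g f) \<alpha> = Reidx P A B f (Reidx P B D g \<alpha>)"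

definition has_finite_meets :: "'p gorder \<Rightarrow> bool" where
  "has_finite_meets L \<longleftrightarrow> lower_semilattice L \<and> weak_partial_order_top L"

definition preserves_finite_meets :: "'p gorder \<Rightarrow> 'q gorder \<Rightarrow> ('p \<Rightarrow> 'q) \<Rightarrow> bool" where
  "preserves_finite_meets L M f \<longleftrightarrow>
     f \<top>\<^bsub>L\<^esub> = \<top>\<^bsub>M\<^esub> \<and>
     (\<forall>x\<in>carrier L. \<forall>y\<in>carrier L. f (x \<sqinter>\<^bsub>L\<^esub> y) = f x \<sqinter>\<^bsub>M\<^esub> f y)"

locale primary_doctrine = is_doctrine +
  assumes fib_meets: "A \<in> Ob (Base P) \<Longrightarrow> has_finite_meets (Fib P A)"
    and reidx_meets:
      "\<lbrakk>A \<in> Ob (Base P); B \<in> Ob (Base P); f \<in> Hom (Base P) A B\<rbrakk>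
        \<Longrightarrow> preserves_finite_meets (Fib P B) (Fib P A) (Reidx P A B f)"

locale doctrine_hom =
  P: is_doctrine P + R: is_doctrine R +
  product_preserving_functor "Base P" "Base R" F
  for P :: "('o, 'a, 'p) doctrine" and R :: "('o2, 'a2, 'p2) doctrine"
    and F :: "('o, 'a, 'o2, 'a2) func" +
  fixes \<ff> :: "'o \<Rightarrow> 'p \<Rightarrow> 'p2"
  assumes component:
      "A \<in> Ob (Base P) \<Longrightarrow> monotone_map (Fib P A) (Fib R (FOb F A)) (\<ff> A)"
    and naturality:
      "\<lbrakk>A \<in> Ob (Base P); B \<in> Ob (Base P); u \<in> Hom (Base P) A B; \<alpha> \<in> carrier (Fib P B)\<rbrakk>
        \<Longrightarrow> \<ff> A (Reidx P A B u \<alpha>) = Reidx R (FOb F A) (FOb F B) (FAr F A B u) (\<ff> B \<alpha>)"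

locale primary_hom =
  doctrine_hom P R F \<ff> + P: primary_doctrine P + R: primary_doctrine R
  for P :: "('o, 'a, 'p) doctrine" and R :: "('o2, 'a2, 'p2) doctrine"
    and F :: "('o, 'a, 'o2, 'a2) func" and \<ff> :: "'o \<Rightarrow> 'p \<Rightarrow> 'p2" +
  assumes component_meets:
    "A \<in> Ob (Base P) \<Longrightarrow> preserves_finite_meets (Fib P A) (Fib R (FOb F A)) (\<ff> A)"

text \<open>\<open>is_exq P B A E\<close> says that \<open>E\<close> is left adjoint to \<open>P(pr\<^sub>1) : P(A) \<rightarrow> P(A \<times> B)\<close>.  Since left
  adjoints are unique on the carrier, \<open>exq P B A\<close> is then the operation \<open>\<exists>\<close> with superscript
  \<open>B\<close> and subscript \<open>A\<close>.\<close>

definition is_exq :: "('o, 'a, 'p) doctrine \<Rightarrow> 'o \<Rightarrow> 'o \<Rightarrow> ('p \<Rightarrow> 'p) \<Rightarrow> bool" where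
  "is_exq P B A E \<longleftrightarrow>
     galois_connection
       \<lparr>orderA = Fib P (A \<^bold>\<times>\<^bsub>Base P\<^esub> B), orderB = Fib P A,
        lower = E, upper = Reidx P (A \<^bold>\<times>\<^bsub>Base P\<^esub> B) A (Pr1 (Base P) A B)\<rparr>"

definition exq :: "('o, 'a, 'p) doctrine \<Rightarrow> 'o \<Rightarrow> 'o \<Rightarrow> 'p \<Rightarrow> 'p" where
  "exq P B A = (SOME E. is_exq P B A E)"

locale existential_doctrine = primary_doctrine +
  assumes left_adjoint:
      "\<lbrakk>B \<in> Ob (Base P); A \<in> Ob (Base P)\<rbrakk> \<Longrightarrow> \<exists>E. is_exq P B A E"
    and beck_chevalley:
      "\<lbrakk>B \<in> Ob (Base P); A \<in> Ob (Base P); A' \<in> Ob (Base P); f \<in> Hom (Base P) A A';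
        \<alpha> \<in> carrier (Fib P (A' \<^bold>\<times>\<^bsub>Base P\<^esub> B))\<rbrakk>
        \<Longrightarrow> exq P B A
              (Reidx P (A \<^bold>\<times>\<^bsub>Base P\<^esub> B) (A' \<^bold>\<times>\<^bsub>Base P\<^esub> B)
                 (cross (Base P) A A' B B f (Id (Base P) B)) \<alpha>)
            = Reidx P A A' f (exq P B A' \<alpha>)"
    and frobenius:
      "\<lbrakk>B \<in> Ob (Base P); A \<in> Ob (Base P);
        \<alpha> \<in> carrier (Fib P (A \<^bold>\<times>\<^bsub>Base P\<^esub> B)); \<beta> \<in> carrier (Fib P A)\<rbrakk>
        \<Longrightarrow> exq P B A
              (\<alpha> \<sqinter>\<^bsub>Fib P (A \<^bold>\<times>\<^bsub>Base P\<^esub> B)\<^esub>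
                 Reidx P (A \<^bold>\<times>\<^bsub>Base P\<^esub> B) A (Pr1 (Base P) A B) \<beta>)
            = exq P B A \<alpha> \<sqinter>\<^bsub>Fib P A\<^esub> \<beta>"

text \<open>As \<open>F\<close> preserves products only up to isomorphism, the component at \<open>A \<times> B\<close> takes values
  in \<open>R(F (A \<times> B))\<close>, which is identified with \<open>R(F A \<times> F B)\<close> by reindexing along the canonical
  isomorphism.\<close>

locale existential_hom =
  primary_hom P R F \<ff> + P: existential_doctrine P + R: existential_doctrine R
  for P :: "('o, 'a, 'p) doctrine" and R :: "('o2, 'a2, 'p2) doctrine"
    and F :: "('o, 'a, 'o2, 'a2) func" and \<ff> :: "'o \<Rightarrow> 'p \<Rightarrow> 'p2" +
  assumes component_exq:
    "\<lbrakk>B \<in> Ob (Base P); A \<in> Ob (Base P); \<alpha> \<in> carrier (Fib P (A \<^bold>\<times>\<^bsub>Base P\<^esub> B))\<rbrakk>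
      \<Longrightarrow> \<ff> A (exq P B A \<alpha>)
          = exq R (FOb F B) (FOb F A)
              (Reidx R (FOb F A \<^bold>\<times>\<^bsub>Base R\<^esub> FOb F B) (FOb F (A \<^bold>\<times>\<^bsub>Base P\<^esub> B))
                 (prod_iso (Base P) (Base R) F A B)
                 (\<ff> (A \<^bold>\<times>\<^bsub>Base P\<^esub> B) \<alpha>))"


section \<open>The Kleisli doctrine\<close>

text \<open>The projections of the Kleisli category are the images of those of \<open>C\<close> under the functor
  \<open>f \<mapsto> f pr\<^sub>2\<close>.\<close>

definition kleisli_category ::
  "('o, 'a) fp_category \<Rightarrow> 'o \<Rightarrow> ('o, 'a) fp_category" where
  "kleisli_category C X =
     \<lparr>Ob = Ob C,
      Hom = (\<lambda>A B. Hom C (X \<^bold>\<times>\<^bsub>C\<^esub> A) B),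
      Id = (\<lambda>A. Pr2 C X A),
      Comp = (\<lambda>A B D h g.
        Comp C (X \<^bold>\<times>\<^bsub>C\<^esub> A) (X \<^bold>\<times>\<^bsub>C\<^esub> B) D h (pair C (X \<^bold>\<times>\<^bsub>C\<^esub> A) X B (Pr1 C X A) g)),
      One = One C,
      Prod = Prod C,
      Pr1 = (\<lambda>A B. Comp C (X \<^bold>\<times>\<^bsub>C\<^esub> (A \<^bold>\<times>\<^bsub>C\<^esub> B)) (A \<^bold>\<times>\<^bsub>C\<^esub> B) A
                     (Pr1 C A B) (Pr2 C X (A \<^bold>\<times>\<^bsub>C\<^esub> B))),
      Pr2 = (\<lambda>A B. Comp C (X \<^bold>\<times>\<^bsub>C\<^esub> (A \<^bold>\<times>\<^bsub>C\<^esub> B)) (A \<^bold>\<times>\<^bsub>C\<^esub> B) B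
                     (Pr2 C A B) (Pr2 C X (A \<^bold>\<times>\<^bsub>C\<^esub> B)))\<rparr>"

definition kleisli_doctrine ::
  "('o, 'a, 'p) doctrine \<Rightarrow> 'o \<Rightarrow> 'p \<Rightarrow> ('o, 'a, 'p) doctrine" where
  "kleisli_doctrine P X \<phi> =
     (let C = Base P in
      \<lparr>Base = kleisli_category C X,
       Fib = (\<lambda>A.
         \<lparr>carrier = {\<alpha> \<in> carrier (Fib P (X \<^bold>\<times>\<^bsub>C\<^esub> A)).
                      \<alpha> \<sqsubseteq>\<^bsub>Fib P (X \<^bold>\<times>\<^bsub>C\<^esub> A)\<^esub> Reidx P (X \<^bold>\<times>\<^bsub>C\<^esub> A) X (Pr1 C X A) \<phi>},
          eq = (=),
          le = le (Fib P (X \<^bold>\<times>\<^bsub>C\<^esub> A))\<rparr>),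
       Reidx = (\<lambda>A B g.
         Reidx P (X \<^bold>\<times>\<^bsub>C\<^esub> A) (X \<^bold>\<times>\<^bsub>C\<^esub> B) (pair C (X \<^bold>\<times>\<^bsub>C\<^esub> A) X B (Pr1 C X A) g))\<rparr>)"

definition kleisli_functor :: "('o, 'a) fp_category \<Rightarrow> 'o \<Rightarrow> ('o, 'a, 'o, 'a) func" where
  "kleisli_functor C X =
     \<lparr>FOb = (\<lambda>A. A), FAr = (\<lambda>A B f. Comp C (X \<^bold>\<times>\<^bsub>C\<^esub> A) A B f (Pr2 C X A))\<rparr>"

definition kleisli_component :: "('o, 'a, 'p) doctrine \<Rightarrow> 'o \<Rightarrow> 'p \<Rightarrow> 'o \<Rightarrow> 'p \<Rightarrow> 'p" where
  "kleisli_component P X \<phi> A \<alpha> =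
     (let C = Base P in
      Reidx P (X \<^bold>\<times>\<^bsub>C\<^esub> A) X (Pr1 C X A) \<phi>
        \<sqinter>\<^bsub>Fib P (X \<^bold>\<times>\<^bsub>C\<^esub> A)\<^esub> Reidx P (X \<^bold>\<times>\<^bsub>C\<^esub> A) A (Pr2 C X A) \<alpha>)"

end

theory Submission
  imports Defs
begin

text \<open>
  Let \<open>a : (X \<times> A) \<times> B \<rightarrow> X \<times> (A \<times> B)\<close> be the associativity isomorphism.  Kleisli reindexing along
  the first projection \<open>A \<times> B \<leadsto> A\<close> is \<open>P(pr\<^sub>1 a\<^sup>-\<^sup>1)\<close>, restricted to the elements below \<open>\<phi>\<close>.  Its
  left adjoint is therefore \<open>\<exists>\<close> of \<open>P\<close> along \<open>(X \<times> A) \<times> B \<rightarrow> X \<times> A\<close> precomposed with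
  \<open>P(a)\<close>, and Beck-Chevalley and Frobenius for it are those of \<open>P\<close> at \<open>\<langle>pr\<^sub>1, f\<rangle>\<close> and at \<open>X \<times> A\<close>.
  The canonical 1-arrow commutes with \<open>\<exists>\<close> by Beck-Chevalley along \<open>pr\<^sub>2 : X \<times> A \<rightarrow> A\<close> followed by
  Frobenius for the reindexed \<open>\<phi>\<close>.
\<close>

section \<open>Calculus of pairings\<close>

context cartesian_category
begin

lemma prod_in_Ob [simp]: "\<lbrakk>A \<in> Ob C; B \<in> Ob C\<rbrakk> \<Longrightarrow> A \<^bold>\<times> B \<in> Ob C"
  and Pr1_in_hom [simp]: "\<lbrakk>A \<in> Ob C; B \<in> Ob C\<rbrakk> \<Longrightarrow> Pr1 C A B \<in> Hom C (A \<^bold>\<times> B) A"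
  and Pr2_in_hom [simp]: "\<lbrakk>A \<in> Ob C; B \<in> Ob C\<rbrakk> \<Longrightarrow> Pr2 C A B \<in> Hom C (A \<^bold>\<times> B) B"
  using prod_product[of A B] by (auto simp: is_product_def)

declare id_in_hom [simp] comp_in_hom [simp] comp_id_right [simp] comp_id_left [simp]

text \<open>Oriented so that simp nests composites to the right: a projection then meets the pairing
  next to it and cancels. With the rules for pairings below, simp decides the equations between
  arrows used later.\<close>

lemma comp_assoc_right [simp]:
  "\<lbrakk>A \<in> Ob C; B \<in> Ob C; D \<in> Ob C; E \<in> Ob C;
    f \<in> Hom C A B; g \<in> Hom C B D; h \<in> Hom C D E\<rbrakk>
    \<Longrightarrow> Comp C A B E (Comp C B D E h g) f = Comp C A D E h (Comp C A B D g f)"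
  by (simp only: comp_assoc)

lemma pair_exists_unique:
  assumes "Z \<in> Ob C" "A \<in> Ob C" "B \<in> Ob C" "f \<in> Hom C Z A" "g \<in> Hom C Z B"
  shows "\<exists>!h. h \<in> Hom C Z (A \<^bold>\<times> B) \<and> Comp C Z (A \<^bold>\<times> B) A (Pr1 C A B) h = f \<and>
    Comp C Z (A \<^bold>\<times> B) B (Pr2 C A B) h = g"
  using prod_product[of A B] assms by (auto simp: is_product_def)

lemma
  assumes "Z \<in> Ob C" "A \<in> Ob C" "B \<in> Ob C" "f \<in> Hom C Z A" "g \<in> Hom C Z B"
  shows pair_in_hom [simp]: "pair C Z A B f g \<in> Hom C Z (A \<^bold>\<times> B)"
    and Pr1_pair [simp]: "Comp C Z (A \<^bold>\<times> B) A (Pr1 C A B) (pair C Z A B f g) = f"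
    and Pr2_pair [simp]: "Comp C Z (A \<^bold>\<times> B) B (Pr2 C A B) (pair C Z A B f g) = g"
  using theI'[OF pair_exists_unique[OF assms]] by (auto simp: pair_def)

lemma pair_eqI:
  assumes "Z \<in> Ob C" "A \<in> Ob C" "B \<in> Ob C" "h \<in> Hom C Z (A \<^bold>\<times> B)"
    "Comp C Z (A \<^bold>\<times> B) A (Pr1 C A B) h = f" "Comp C Z (A \<^bold>\<times> B) B (Pr2 C A B) h = g"
  shows "pair C Z A B f g = h"
proof -
  have "f \<in> Hom C Z A" "g \<in> Hom C Z B" using assms by auto
  from pair_exists_unique[OF assms(1-3) this] show ?thesis
    unfolding pair_def by (rule the1_equality) (use assms in simp)
qed

lemma pair_Pr1_Pr2 [simp]:
  "\<lbrakk>A \<in> Ob C; B \<in> Ob C\<rbrakk> \<Longrightarrow> pair C (A \<^bold>\<times> B) A B (Pr1 C A B) (Pr2 C A B) = Id C (A \<^bold>\<times> B)"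
  by (rule pair_eqI) simp_all

lemma pair_eta [simp]:
  "\<lbrakk>Z \<in> Ob C; A \<in> Ob C; B \<in> Ob C; h \<in> Hom C Z (A \<^bold>\<times> B)\<rbrakk>
    \<Longrightarrow> pair C Z A B (Comp C Z (A \<^bold>\<times> B) A (Pr1 C A B) h) (Comp C Z (A \<^bold>\<times> B) B (Pr2 C A B) h) = h"
  by (rule pair_eqI) simp_all

lemma pair_comp [simp]:
  assumes "Y \<in> Ob C" "Z \<in> Ob C" "A \<in> Ob C" "B \<in> Ob C"
    "h \<in> Hom C Y Z" "f \<in> Hom C Z A" "g \<in> Hom C Z B"
  shows "Comp C Y Z (A \<^bold>\<times> B) (pair C Z A B f g) h =
    pair C Y A B (Comp C Y Z A f h) (Comp C Y Z B g h)"
  \<comment> \<open>Here the nesting must go to the left instead, so that the projection reaches the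
    pairing before \<open>h\<close> does.\<close>
  using assms by (intro pair_eqI[symmetric]) (simp_all flip: comp_assoc_right)

end


section \<open>The Kleisli category\<close>

lemma kleisli_category_simps [simp]:
  "Ob (kleisli_category C X) = Ob C"
  "Hom (kleisli_category C X) A B = Hom C (X \<^bold>\<times>\<^bsub>C\<^esub> A) B"
  "Id (kleisli_category C X) A = Pr2 C X A"
  "Comp (kleisli_category C X) A B D h g =
    Comp C (X \<^bold>\<times>\<^bsub>C\<^esub> A) (X \<^bold>\<times>\<^bsub>C\<^esub> B) D h (pair C (X \<^bold>\<times>\<^bsub>C\<^esub> A) X B (Pr1 C X A) g)"
  "One (kleisli_category C X) = One C"
  "A \<^bold>\<times>\<^bsub>kleisli_category C X\<^esub> B = A \<^bold>\<times>\<^bsub>C\<^esub> B"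
  "Pr1 (kleisli_category C X) A B =
    Comp C (X \<^bold>\<times>\<^bsub>C\<^esub> (A \<^bold>\<times>\<^bsub>C\<^esub> B)) (A \<^bold>\<times>\<^bsub>C\<^esub> B) A (Pr1 C A B) (Pr2 C X (A \<^bold>\<times>\<^bsub>C\<^esub> B))"
  "Pr2 (kleisli_category C X) A B =
    Comp C (X \<^bold>\<times>\<^bsub>C\<^esub> (A \<^bold>\<times>\<^bsub>C\<^esub> B)) (A \<^bold>\<times>\<^bsub>C\<^esub> B) B (Pr2 C A B) (Pr2 C X (A \<^bold>\<times>\<^bsub>C\<^esub> B))"
  by (simp_all add: kleisli_category_def)

lemma kleisli_functor_simps [simp]:
  "FOb (kleisli_functor C X) A = A"
  "FAr (kleisli_functor C X) A B f = Comp C (X \<^bold>\<times>\<^bsub>C\<^esub> A) A B f (Pr2 C X A)"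
  by (simp_all add: kleisli_functor_def)

context cartesian_category
begin

lemma kleisli_terminal:
  assumes X: "X \<in> Ob C" and T: "is_terminal C T"
  shows "is_terminal (kleisli_category C X) T"
  using assms by (simp add: is_terminal_def)

text \<open>The Kleisli composite of \<open>p Pr2\<close> with \<open>h\<close> is just
  \<open>p h\<close>, so the universal property of \<open>Q\<close> at \<open>Z\<close> in the
  Kleisli category is that of \<open>Q\<close> at \<open>X \<times> Z\<close> in \<open>C\<close>.
  The cone is arbitrary because the result serves both for the chosen products and for preservation
  of all products by the functor.\<close>

lemma kleisli_product:
  assumes X: "X \<in> Ob C" and AB: "A \<in> Ob C" "B \<in> Ob C" and Q: "is_product C A B Q p q"
  shows "is_product (kleisli_category C X) A B Q
    (Comp C (X \<^bold>\<times> Q) Q A p (Pr2 C X Q)) (Comp C (X \<^bold>\<times> Q) Q B q (Pr2 C X Q))"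
proof -
  have QO: "Q \<in> Ob C" and pq: "p \<in> Hom C Q A" "q \<in> Hom C Q B"
    and un: "\<And>Z f g. \<lbrakk>Z \<in> Ob C; f \<in> Hom C Z A; g \<in> Hom C Z B\<rbrakk> \<Longrightarrow>
      \<exists>!h. h \<in> Hom C Z Q \<and> Comp C Z Q A p h = f \<and> Comp C Z Q B q h = g"
    using Q by (auto simp: is_product_def)
  have "\<exists>!h. h \<in> Hom C (X \<^bold>\<times> Z) Q \<and>
      Comp C (X \<^bold>\<times> Z) (X \<^bold>\<times> Q) A (Comp C (X \<^bold>\<times> Q) Q A p (Pr2 C X Q))
        (pair C (X \<^bold>\<times> Z) X Q (Pr1 C X Z) h) = f \<and>
      Comp C (X \<^bold>\<times> Z) (X \<^bold>\<times> Q) B (Comp C (X \<^bold>\<times> Q) Q B q (Pr2 C X Q))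
        (pair C (X \<^bold>\<times> Z) X Q (Pr1 C X Z) h) = g"
    if "Z \<in> Ob C" "f \<in> Hom C (X \<^bold>\<times> Z) A" "g \<in> Hom C (X \<^bold>\<times> Z) B" for Z f g
    \<comment> \<open>\<open>conj_cong\<close> supplies the typing of \<open>h\<close> while the two
      Kleisli composites are simplified.\<close>
    using un[of "X \<^bold>\<times> Z" f g] X AB QO pq that by (simp cong: conj_cong)
  then show ?thesis using X AB QO pq by (simp add: is_product_def)
qed

lemma kleisli_cartesian:
  assumes X: "X \<in> Ob C"
  shows "cartesian_category (kleisli_category C X)"
proof
  show "is_terminal (kleisli_category C X) (One (kleisli_category C X))"
    using kleisli_terminal[OF X one_terminal] by simp
  show "is_product (kleisli_category C X) A B (A \<^bold>\<times>\<^bsub>kleisli_category C X\<^esub> B)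
      (Pr1 (kleisli_category C X) A B) (Pr2 (kleisli_category C X) A B)"
    if "A \<in> Ob (kleisli_category C X)" "B \<in> Ob (kleisli_category C X)" for A B
    using that kleisli_product[OF X _ _ prod_product[of A B]] by simp
\<comment> \<open>The category laws become identities about pairings of the form
  \<open><Pr1, g>\<close>.\<close>
qed (use X in simp_all)

lemma kleisli_functor_preserves_products:
  assumes X: "X \<in> Ob C"
  shows "product_preserving_functor C (kleisli_category C X) (kleisli_functor C X)"
proof -
  interpret K: cartesian_category "kleisli_category C X"
    using X by (rule kleisli_cartesian)
  show ?thesis
    by unfold_locales
      (use X in \<open>simp_all add: kleisli_terminal kleisli_product\<close>)
qed

text \<open>Needed to compute \<open>cross\<close> in the Kleisli category for
  Beck-Chevalley.\<close>

lemma kleisli_pair: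
  assumes X: "X \<in> Ob C" and "Z \<in> Ob C" "A \<in> Ob C" "B \<in> Ob C"
    "f \<in> Hom C (X \<^bold>\<times> Z) A" "g \<in> Hom C (X \<^bold>\<times> Z) B"
  shows "pair (kleisli_category C X) Z A B f g = pair C (X \<^bold>\<times> Z) A B f g"
proof -
  interpret K: cartesian_category "kleisli_category C X"
    using X by (rule kleisli_cartesian)
  show ?thesis by (rule K.pair_eqI) (use assms in simp_all)
qed

text \<open>The functor fixes objects and sends the projections of \<open>C\<close> to the chosen
  Kleisli projections, so the comparison arrow is the pairing of the Kleisli projections, which is
  the Kleisli identity.\<close>

lemma kleisli_prod_iso:
  assumes X: "X \<in> Ob C" and "A \<in> Ob C" "B \<in> Ob C"
  shows "prod_iso C (kleisli_category C X) (kleisli_functor C X) A B = Pr2 C X (A \<^bold>\<times> B)"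
proof -
  interpret K: cartesian_category "kleisli_category C X"
    using X by (rule kleisli_cartesian)
  show ?thesis
    using K.pair_Pr1_Pr2[of A B] assms(2,3) by (simp add: prod_iso_def pair_def)
qed

end

definition assoc_arrow :: "('o, 'a) fp_category \<Rightarrow> 'o \<Rightarrow> 'o \<Rightarrow> 'o \<Rightarrow> 'a" where
  "assoc_arrow C X A B =
     (let Q = (X \<^bold>\<times>\<^bsub>C\<^esub> A) \<^bold>\<times>\<^bsub>C\<^esub> B; p = Pr1 C (X \<^bold>\<times>\<^bsub>C\<^esub> A) B in
      pair C Q X (A \<^bold>\<times>\<^bsub>C\<^esub> B)
        (Comp C Q (X \<^bold>\<times>\<^bsub>C\<^esub> A) X (Pr1 C X A) p)
        (pair C Q A B (Comp C Q (X \<^bold>\<times>\<^bsub>C\<^esub> A) A (Pr2 C X A) p) (Pr2 C (X \<^bold>\<times>\<^bsub>C\<^esub> A) B)))"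


section \<open>Principal down-sets\<close>

text \<open>The Kleisli fibres have this form, with \<open>m\<close> the reindexed \<phi>, which
  isolates the order theory they need.\<close>

definition down_set :: "('p, 'b) gorder_scheme \<Rightarrow> 'p \<Rightarrow> 'p gorder" where
  "down_set L m = \<lparr>carrier = {x \<in> carrier L. x \<sqsubseteq>\<^bsub>L\<^esub> m}, eq = (=), le = le L\<rparr>"

lemma down_set_simps [simp]:
  "x \<in> carrier (down_set L m) \<longleftrightarrow> x \<in> carrier L \<and> x \<sqsubseteq>\<^bsub>L\<^esub> m"
  "le (down_set L m) = le L"
  "eq (down_set L m) = (=)"
  by (simp_all add: down_set_def)

lemma (in partial_order) down_set_partial_order:
  "partial_order (down_set L m)"
  by unfold_locales (auto intro: le_trans)

text \<open>Tops, like the meets below, are picked by \<open>SOME\<close>; antisymmetry makes the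
  choice unique and hence computable.\<close>

lemma (in partial_order) top_eqI:
  assumes "t \<in> carrier L" "\<And>x. x \<in> carrier L \<Longrightarrow> x \<sqsubseteq> t"
  shows "\<top> = t"
proof -
  have t: "greatest L t (carrier L)" using assms by (auto simp: greatest_def)
  then show ?thesis unfolding top_def by (rule some_equality) (rule greatest_unique[OF _ t])
qed

lemma (in partial_order) meet_eqI:
  assumes "x \<in> carrier L" "y \<in> carrier L" "m \<in> carrier L" "m \<sqsubseteq> x" "m \<sqsubseteq> y"
    and "\<And>z. \<lbrakk>z \<in> carrier L; z \<sqsubseteq> x; z \<sqsubseteq> y\<rbrakk> \<Longrightarrow> z \<sqsubseteq> m"
  shows "x \<sqinter> y = m"
proof -
  have m: "greatest L m (Lower L {x, y})"
    using assms by (intro greatest_LowerI) (auto simp: Lower_def)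
  then show ?thesis unfolding meet_def inf_def
    by (rule some_equality) (rule greatest_unique[OF _ m])
qed

text \<open>A meet of elements below \<open>m\<close> is again below \<open>m\<close>, so it is also
  the greatest lower bound inside the down-set.\<close>

lemma (in lower_semilattice) down_set_meet:
  assumes "x \<in> carrier (down_set L m)" "y \<in> carrier (down_set L m)" "m \<in> carrier L"
  shows "x \<sqinter>\<^bsub>down_set L m\<^esub> y = x \<sqinter> y"
proof -
  have "x \<sqinter> y \<sqsubseteq> m"
    using assms by (auto intro: le_trans[OF meet_left])
  then show ?thesis
    by (intro partial_order.meet_eqI[OF down_set_partial_order])
      (use assms in \<open>auto intro: meet_left meet_right meet_le\<close>)
qed

lemma (in partial_order) down_set_top:
  "m \<in> carrier L \<Longrightarrow> \<top>\<^bsub>down_set L m\<^esub> = m"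
  by (rule partial_order.top_eqI[OF down_set_partial_order]) auto

lemma (in lower_semilattice) down_set_finite_meets:
  assumes m: "m \<in> carrier L"
  shows "has_finite_meets (down_set L m)"
proof -
  interpret D: partial_order "down_set L m" by (rule down_set_partial_order)
  have "\<exists>t. greatest (down_set L m) t (carrier (down_set L m))"
    using m by (intro exI[of _ m]) (auto simp: greatest_def)
  moreover have "\<exists>s. is_glb (down_set L m) s {x, y}"
    if "x \<in> carrier (down_set L m)" "y \<in> carrier (down_set L m)" for x y
  proof -
    have "x \<sqinter> y \<sqsubseteq> m" using that m by (auto intro: le_trans[OF meet_left])
    then have "is_glb (down_set L m) (x \<sqinter> y) {x, y}"
      using that by (intro greatest_LowerI) (auto simp: Lower_def intro: meet_left meet_right meet_le)
    then show ?thesis ..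
  qed
  ultimately show ?thesis
    unfolding has_finite_meets_def by (intro conjI) (unfold_locales, auto)
qed


section \<open>Primary and existential doctrines\<close>

sublocale is_doctrine \<subseteq> cart: cartesian_category "Base P"
  by (rule base)

context is_doctrine
begin

lemma reidx_closed [simp]:
  "\<lbrakk>A \<in> Ob (Base P); B \<in> Ob (Base P); f \<in> Hom (Base P) A B; \<alpha> \<in> carrier (Fib P B)\<rbrakk>
    \<Longrightarrow> Reidx P A B f \<alpha> \<in> carrier (Fib P A)"
  using reidx[of A B f] by (auto simp: monotone_map_def)

lemma reidx_mono:
  "\<lbrakk>\<alpha> \<sqsubseteq>\<^bsub>Fib P B\<^esub> \<beta>; A \<in> Ob (Base P); B \<in> Ob (Base P); f \<in> Hom (Base P) A B;
    \<alpha> \<in> carrier (Fib P B); \<beta> \<in> carrier (Fib P B)\<rbrakk>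
    \<Longrightarrow> Reidx P A B f \<alpha> \<sqsubseteq>\<^bsub>Fib P A\<^esub> Reidx P A B f \<beta>"
  using reidx[of A B f] by (auto simp: monotone_map_def isotone_def)

text \<open>Merging iterated reindexings turns an equation between them into an equation between
  arrows, which the calculus of pairings settles.\<close>

lemma reidx_reidx [simp]:
  "\<lbrakk>A \<in> Ob (Base P); B \<in> Ob (Base P); D \<in> Ob (Base P);
    f \<in> Hom (Base P) A B; g \<in> Hom (Base P) B D; \<alpha> \<in> carrier (Fib P D)\<rbrakk>
    \<Longrightarrow> Reidx P A B f (Reidx P B D g \<alpha>) = Reidx P A D (Comp (Base P) A B D g f) \<alpha>"
  by (simp only: reidx_comp)

declare reidx_id [simp]

text \<open>Two left adjoints of the same map agree: the unit of each shows that the other lies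
  below it. So \<open>exq\<close>, a mere choice, can be computed from any explicit adjoint, but
  only on the carrier.\<close>

lemma exq_eq:
  assumes E: "is_exq P B A E" and \<alpha>: "\<alpha> \<in> carrier (Fib P (A \<^bold>\<times>\<^bsub>Base P\<^esub> B))"
  shows "exq P B A \<alpha> = E \<alpha>"
proof -
  have "is_exq P B A (exq P B A)" unfolding exq_def by (rule someI[where P = "is_exq P B A", OF E])
  then interpret G: galois_connection
    "\<lparr>orderA = Fib P (A \<^bold>\<times>\<^bsub>Base P\<^esub> B), orderB = Fib P A, lower = exq P B A,
      upper = Reidx P (A \<^bold>\<times>\<^bsub>Base P\<^esub> B) A (Pr1 (Base P) A B)\<rparr>"
    by (simp add: is_exq_def)
  interpret H: galois_connection
    "\<lparr>orderA = Fib P (A \<^bold>\<times>\<^bsub>Base P\<^esub> B), orderB = Fib P A, lower = E,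
      upper = Reidx P (A \<^bold>\<times>\<^bsub>Base P\<^esub> B) A (Pr1 (Base P) A B)\<rparr>"
    using E by (simp add: is_exq_def)
  interpret L: partial_order "Fib P A" using G.is_order_B by simp
  show ?thesis
    using \<alpha> G.lower_closed H.lower_closed G.inflation H.inflation G.left H.left
    by (intro L.le_antisym) auto
qed

end

context primary_doctrine
begin

lemma fib_semilattice: "A \<in> Ob (Base P) \<Longrightarrow> lower_semilattice (Fib P A)"
  using fib_meets by (simp add: has_finite_meets_def)

lemma meet_closed [simp]:
  "\<lbrakk>A \<in> Ob (Base P); \<alpha> \<in> carrier (Fib P A); \<beta> \<in> carrier (Fib P A)\<rbrakk>
    \<Longrightarrow> \<alpha> \<sqinter>\<^bsub>Fib P A\<^esub> \<beta> \<in> carrier (Fib P A)"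
proof -
  assume A: "A \<in> Ob (Base P)"
  interpret lower_semilattice "Fib P A" using A by (rule fib_semilattice)
  show "\<lbrakk>\<alpha> \<in> carrier (Fib P A); \<beta> \<in> carrier (Fib P A)\<rbrakk> \<Longrightarrow> ?thesis" by simp
qed

lemma reidx_meet [simp]:
  "\<lbrakk>A \<in> Ob (Base P); B \<in> Ob (Base P); f \<in> Hom (Base P) A B;
    \<alpha> \<in> carrier (Fib P B); \<beta> \<in> carrier (Fib P B)\<rbrakk>
    \<Longrightarrow> Reidx P A B f (\<alpha> \<sqinter>\<^bsub>Fib P B\<^esub> \<beta>) = Reidx P A B f \<alpha> \<sqinter>\<^bsub>Fib P A\<^esub> Reidx P A B f \<beta>"
  using reidx_meets by (simp add: preserves_finite_meets_def)

lemma reidx_top: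
  "\<lbrakk>A \<in> Ob (Base P); B \<in> Ob (Base P); f \<in> Hom (Base P) A B\<rbrakk>
    \<Longrightarrow> Reidx P A B f \<top>\<^bsub>Fib P B\<^esub> = \<top>\<^bsub>Fib P A\<^esub>"
  using reidx_meets by (simp add: preserves_finite_meets_def)

end

context existential_doctrine
begin

lemma exq_is_exq:
  "\<lbrakk>B \<in> Ob (Base P); A \<in> Ob (Base P)\<rbrakk> \<Longrightarrow> is_exq P B A (exq P B A)"
  unfolding exq_def using left_adjoint by (rule someI_ex)

lemma exq_closed [simp]:
  assumes "B \<in> Ob (Base P)" "A \<in> Ob (Base P)" "\<alpha> \<in> carrier (Fib P (A \<^bold>\<times>\<^bsub>Base P\<^esub> B))"
  shows "exq P B A \<alpha> \<in> carrier (Fib P A)"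
  using galois_connection.axioms(1)[OF exq_is_exq[unfolded is_exq_def], THEN connection.lower_closed]
    assms by force

lemma exq_le_iff:
  assumes "B \<in> Ob (Base P)" "A \<in> Ob (Base P)" "\<alpha> \<in> carrier (Fib P (A \<^bold>\<times>\<^bsub>Base P\<^esub> B))"
    "\<beta> \<in> carrier (Fib P A)"
  shows "exq P B A \<alpha> \<sqsubseteq>\<^bsub>Fib P A\<^esub> \<beta> \<longleftrightarrow>
    \<alpha> \<sqsubseteq>\<^bsub>Fib P (A \<^bold>\<times>\<^bsub>Base P\<^esub> B)\<^esub> Reidx P (A \<^bold>\<times>\<^bsub>Base P\<^esub> B) A (Pr1 (Base P) A B) \<beta>"
  using galois_connection.galois_property[OF exq_is_exq[unfolded is_exq_def]] assms by force

end


section \<open>The Kleisli doctrine\<close>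

locale kleisli_construction = primary_doctrine P
  for P :: "('o, 'a, 'p) doctrine" +
  fixes X :: 'o and \<phi> :: 'p
  assumes X [simp]: "X \<in> Ob (Base P)"
    and \<phi> [simp]: "\<phi> \<in> carrier (Fib P X)"
begin

abbreviation C where "C \<equiv> Base P"
abbreviation K where "K \<equiv> kleisli_doctrine P X \<phi>"

abbreviation bound :: "'o \<Rightarrow> 'p" where
  "bound A \<equiv> Reidx P (X \<^bold>\<times>\<^bsub>C\<^esub> A) X (Pr1 C X A) \<phi>"

lemma kleisli_doctrine_simps [simp]:
  "Base K = kleisli_category C X"
  "Fib K A = down_set (Fib P (X \<^bold>\<times>\<^bsub>C\<^esub> A)) (bound A)"
  "Reidx K A B g =
    Reidx P (X \<^bold>\<times>\<^bsub>C\<^esub> A) (X \<^bold>\<times>\<^bsub>C\<^esub> B) (pair C (X \<^bold>\<times>\<^bsub>C\<^esub> A) X B (Pr1 C X A) g)"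
  by (simp_all add: kleisli_doctrine_def down_set_def Let_def)

text \<open>Since \<open>Pr1\<close> after \<open><Pr1, g>\<close> is \<open>Pr1\<close>, reindexing
  sends \<open>bound B\<close> to \<open>bound A\<close>; monotonicity does the rest.\<close>

lemma kleisli_reidx_le:
  assumes "A \<in> Ob C" "B \<in> Ob C" "g \<in> Hom C (X \<^bold>\<times>\<^bsub>C\<^esub> A) B"
    "\<alpha> \<in> carrier (Fib P (X \<^bold>\<times>\<^bsub>C\<^esub> B))" "\<alpha> \<sqsubseteq>\<^bsub>Fib P (X \<^bold>\<times>\<^bsub>C\<^esub> B)\<^esub> bound B"
  shows "Reidx P (X \<^bold>\<times>\<^bsub>C\<^esub> A) (X \<^bold>\<times>\<^bsub>C\<^esub> B) (pair C (X \<^bold>\<times>\<^bsub>C\<^esub> A) X B (Pr1 C X A) g) \<alpha>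
    \<sqsubseteq>\<^bsub>Fib P (X \<^bold>\<times>\<^bsub>C\<^esub> A)\<^esub> bound A"
  using reidx_mono[OF assms(5), of "X \<^bold>\<times>\<^bsub>C\<^esub> A" "pair C (X \<^bold>\<times>\<^bsub>C\<^esub> A) X B (Pr1 C X A) g"] assms
  by simp

lemma kleisli_is_doctrine: "is_doctrine K"
proof (rule is_doctrine.intro)
  show "cartesian_category (Base K)" by (simp add: cart.kleisli_cartesian)
  have fibK: "partial_order (Fib K A)" if "A \<in> Ob C" for A
    using that by (simp add: fib partial_order.down_set_partial_order)
  then show "partial_order (Fib K A)" if "A \<in> Ob (Base K)" for A
    using that by simp
  show "monotone_map (Fib K B) (Fib K A) (Reidx K A B f)"
    if "A \<in> Ob (Base K)" "B \<in> Ob (Base K)" "f \<in> Hom (Base K) A B" for A B f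
    using that fibK[of A] fibK[of B]
    by (auto simp: monotone_map_def isotone_def kleisli_reidx_le reidx_mono
        intro: partial_order.axioms(1))
\<comment> \<open>Functoriality of reindexing: \<open><Pr1, Pr2>\<close> is the identity, and
  lifting \<open>g\<close> to \<open><Pr1, g>\<close> turns Kleisli composition into composition in
  \<open>C\<close>.\<close>
qed simp_all

text \<open>The top of a Kleisli fibre is its bound, which reindexing preserves, and binary meets
  are those of \<open>P\<close>.\<close>

lemma kleisli_primary: "primary_doctrine K"
proof -
  interpret K: is_doctrine K by (rule kleisli_is_doctrine)
  show ?thesis
  proof
    fix A assume A: "A \<in> Ob (Base K)"
    show "has_finite_meets (Fib K A)"
      using A by (simp add: fib_semilattice lower_semilattice.down_set_finite_meets)
  next
    fix A B f assume "A \<in> Ob (Base K)" "B \<in> Ob (Base K)" "f \<in> Hom (Base K) A B"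
    then show "preserves_finite_meets (Fib K B) (Fib K A) (Reidx K A B f)"
      by (simp add: preserves_finite_meets_def fib partial_order.down_set_top
          fib_semilattice lower_semilattice.down_set_meet kleisli_reidx_le)
  qed
qed

section \<open>The canonical 1-arrow is primary\<close>

lemma kleisli_component_closed:
  assumes "A \<in> Ob C" "\<alpha> \<in> carrier (Fib P A)"
  shows "kleisli_component P X \<phi> A \<alpha> \<in> carrier (Fib K A)"
proof -
  interpret L: lower_semilattice "Fib P (X \<^bold>\<times>\<^bsub>C\<^esub> A)" using assms by (simp add: fib_semilattice)
  show ?thesis using assms by (simp add: kleisli_component_def Let_def L.meet_left)
qed

lemma kleisli_component_mono:
  assumes "A \<in> Ob C" "\<alpha> \<in> carrier (Fib P A)" "\<beta> \<in> carrier (Fib P A)" "\<alpha> \<sqsubseteq>\<^bsub>Fib P A\<^esub> \<beta>"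
  shows "kleisli_component P X \<phi> A \<alpha> \<sqsubseteq>\<^bsub>Fib K A\<^esub> kleisli_component P X \<phi> A \<beta>"
proof -
  interpret L: lower_semilattice "Fib P (X \<^bold>\<times>\<^bsub>C\<^esub> A)" using assms by (simp add: fib_semilattice)
  have "Reidx P (X \<^bold>\<times>\<^bsub>C\<^esub> A) A (Pr2 C X A) \<alpha> \<sqsubseteq>\<^bsub>Fib P (X \<^bold>\<times>\<^bsub>C\<^esub> A)\<^esub> Reidx P (X \<^bold>\<times>\<^bsub>C\<^esub> A) A (Pr2 C X A) \<beta>"
    using assms by (simp add: reidx_mono)
  then show ?thesis
    using assms
    by (auto simp: kleisli_component_def Let_def intro!: L.meet_le L.meet_left
        intro: L.le_trans[OF L.meet_right])
qed

lemma kleisli_component_meet: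
  assumes A: "A \<in> Ob C" and \<alpha>: "\<alpha> \<in> carrier (Fib P A)" and \<beta>: "\<beta> \<in> carrier (Fib P A)"
  shows "kleisli_component P X \<phi> A (\<alpha> \<sqinter>\<^bsub>Fib P A\<^esub> \<beta>) =
    kleisli_component P X \<phi> A \<alpha> \<sqinter>\<^bsub>Fib K A\<^esub> kleisli_component P X \<phi> A \<beta>"
proof -
  let ?L = "Fib P (X \<^bold>\<times>\<^bsub>C\<^esub> A)"
  interpret L: lower_semilattice ?L using A by (simp add: fib_semilattice)
  \<comment> \<open>After reindexing has been moved through the meet, only this is left; it rests on
    the idempotence of meets, which lets \<open>b\<close> be duplicated.\<close>
  have distrib: "b \<sqinter>\<^bsub>?L\<^esub> (x \<sqinter>\<^bsub>?L\<^esub> y) = (b \<sqinter>\<^bsub>?L\<^esub> x) \<sqinter>\<^bsub>?L\<^esub> (b \<sqinter>\<^bsub>?L\<^esub> y)"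
    if "b \<in> carrier ?L" "x \<in> carrier ?L" "y \<in> carrier ?L" for b x y
  proof (rule L.le_antisym)
    show "b \<sqinter>\<^bsub>?L\<^esub> (x \<sqinter>\<^bsub>?L\<^esub> y) \<sqsubseteq>\<^bsub>?L\<^esub> (b \<sqinter>\<^bsub>?L\<^esub> x) \<sqinter>\<^bsub>?L\<^esub> (b \<sqinter>\<^bsub>?L\<^esub> y)"
      using that
      by (intro L.meet_le L.meet_left L.le_trans[OF L.meet_right L.meet_left]
          L.le_trans[OF L.meet_right L.meet_right]) simp_all
    show "(b \<sqinter>\<^bsub>?L\<^esub> x) \<sqinter>\<^bsub>?L\<^esub> (b \<sqinter>\<^bsub>?L\<^esub> y) \<sqsubseteq>\<^bsub>?L\<^esub> b \<sqinter>\<^bsub>?L\<^esub> (x \<sqinter>\<^bsub>?L\<^esub> y)"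
      using that
      by (intro L.meet_le L.le_trans[OF L.meet_left L.meet_left]
          L.le_trans[OF L.meet_left L.meet_right] L.le_trans[OF L.meet_right L.meet_right]) simp_all
  qed (use that in simp_all)
  show ?thesis
    using assms kleisli_component_closed[OF A \<alpha>] kleisli_component_closed[OF A \<beta>]
    by (simp add: L.down_set_meet)
      (simp add: kleisli_component_def Let_def, intro distrib, simp_all)
qed

lemma kleisli_component_top:
  assumes A: "A \<in> Ob C"
  shows "kleisli_component P X \<phi> A \<top>\<^bsub>Fib P A\<^esub> = \<top>\<^bsub>Fib K A\<^esub>"
proof -
  let ?L = "Fib P (X \<^bold>\<times>\<^bsub>C\<^esub> A)"
  interpret L: lower_semilattice ?L using A by (simp add: fib_semilattice)
  interpret T: weak_partial_order_top ?L using A fib_meets by (simp add: has_finite_meets_def)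
  have "bound A \<sqinter>\<^bsub>?L\<^esub> \<top>\<^bsub>?L\<^esub> = bound A"
    using A by (intro L.meet_eqI) auto
  then show ?thesis
    using A by (simp add: kleisli_component_def Let_def reidx_top L.down_set_top)
qed

lemma kleisli_primary_hom:
  "primary_hom P K (kleisli_functor C X) (kleisli_component P X \<phi>)"
proof -
  interpret K: primary_doctrine K by (rule kleisli_primary)
  interpret F: product_preserving_functor "Base P" "Base K" "kleisli_functor C X"
    using cart.kleisli_functor_preserves_products by simp
  show ?thesis
  proof unfold_locales
    fix A assume A: "A \<in> Ob C"
    show "monotone_map (Fib P A) (Fib K (FOb (kleisli_functor C X) A)) (kleisli_component P X \<phi> A)"
      unfolding monotone_map_def isotone_def
      using A kleisli_component_closed kleisli_component_mono fib[OF A] K.fib[of A]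
      by (auto intro: partial_order.axioms(1))
    show "preserves_finite_meets (Fib P A) (Fib K (FOb (kleisli_functor C X) A))
        (kleisli_component P X \<phi> A)"
      using A kleisli_component_meet kleisli_component_top by (simp add: preserves_finite_meets_def)
  \<comment> \<open>Naturality: the lift of \<open>u Pr2\<close> is \<open><Pr1, u Pr2>\<close>, so
    both sides are the meet of \<open>bound A\<close> with \<alpha> reindexed along
    \<open>u Pr2\<close>.\<close>
  qed (simp add: kleisli_component_def Let_def)
qed

end

section \<open>Existential quantifiers in the Kleisli doctrine\<close>

locale kleisli_existential = kleisli_construction P X \<phi> + existential_doctrine P
  for P :: "('o, 'a, 'p) doctrine" and X \<phi>
begin

text \<open>Its argument ranges over the whole fibre of \<open>P\<close>, so the adjunction and
  Frobenius can be proved there before restricting to elements below the bound.\<close>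

definition kleisli_exq :: "'o \<Rightarrow> 'o \<Rightarrow> 'p \<Rightarrow> 'p" where
  "kleisli_exq B A \<alpha> = exq P B (X \<^bold>\<times>\<^bsub>C\<^esub> A)
     (Reidx P ((X \<^bold>\<times>\<^bsub>C\<^esub> A) \<^bold>\<times>\<^bsub>C\<^esub> B) (X \<^bold>\<times>\<^bsub>C\<^esub> (A \<^bold>\<times>\<^bsub>C\<^esub> B)) (assoc_arrow C X A B) \<alpha>)"

text \<open>Reindexing along the associativity isomorphism and along its inverse is monotone, and
  the isomorphism carries the lifted Kleisli projection \<open><Pr1, Pr1 Pr2>\<close> to the
  projection \<open>(X \<times> A) \<times> B \<rightarrow> X \<times> A\<close>.\<close>

lemma reidx_assoc_le_iff:
  assumes "A \<in> Ob C" "B \<in> Ob C" "\<alpha> \<in> carrier (Fib P (X \<^bold>\<times>\<^bsub>C\<^esub> (A \<^bold>\<times>\<^bsub>C\<^esub> B)))"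
    "\<beta> \<in> carrier (Fib P (X \<^bold>\<times>\<^bsub>C\<^esub> A))"
  shows "Reidx P ((X \<^bold>\<times>\<^bsub>C\<^esub> A) \<^bold>\<times>\<^bsub>C\<^esub> B) (X \<^bold>\<times>\<^bsub>C\<^esub> (A \<^bold>\<times>\<^bsub>C\<^esub> B)) (assoc_arrow C X A B) \<alpha>
      \<sqsubseteq>\<^bsub>Fib P ((X \<^bold>\<times>\<^bsub>C\<^esub> A) \<^bold>\<times>\<^bsub>C\<^esub> B)\<^esub>
      Reidx P ((X \<^bold>\<times>\<^bsub>C\<^esub> A) \<^bold>\<times>\<^bsub>C\<^esub> B) (X \<^bold>\<times>\<^bsub>C\<^esub> A) (Pr1 C (X \<^bold>\<times>\<^bsub>C\<^esub> A) B) \<beta> \<longleftrightarrow>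
    \<alpha> \<sqsubseteq>\<^bsub>Fib P (X \<^bold>\<times>\<^bsub>C\<^esub> (A \<^bold>\<times>\<^bsub>C\<^esub> B))\<^esub> Reidx K (A \<^bold>\<times>\<^bsub>C\<^esub> B) A (Pr1 (Base K) A B) \<beta>"
    (is "?l \<sqsubseteq>\<^bsub>?L\<^esub> ?r \<longleftrightarrow> \<alpha> \<sqsubseteq>\<^bsub>?M\<^esub> ?s")
proof
  let ?Q = "X \<^bold>\<times>\<^bsub>C\<^esub> (A \<^bold>\<times>\<^bsub>C\<^esub> B)"
  \<comment> \<open>The inverse of \<open>assoc_arrow\<close>, sending \<open>(x, (a, b))\<close> to
    \<open>((x, a), b)\<close>.\<close>
  let ?i = "pair C ?Q (X \<^bold>\<times>\<^bsub>C\<^esub> A) B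
    (pair C ?Q X A (Pr1 C X (A \<^bold>\<times>\<^bsub>C\<^esub> B))
       (Comp C ?Q (A \<^bold>\<times>\<^bsub>C\<^esub> B) A (Pr1 C A B) (Pr2 C X (A \<^bold>\<times>\<^bsub>C\<^esub> B))))
    (Comp C ?Q (A \<^bold>\<times>\<^bsub>C\<^esub> B) B (Pr2 C A B) (Pr2 C X (A \<^bold>\<times>\<^bsub>C\<^esub> B)))"
  assume "?l \<sqsubseteq>\<^bsub>?L\<^esub> ?r"
  from reidx_mono[OF this, of ?Q ?i] show "\<alpha> \<sqsubseteq>\<^bsub>?M\<^esub> ?s"
    using assms by (simp add: assoc_arrow_def Let_def)
next
  assume "\<alpha> \<sqsubseteq>\<^bsub>?M\<^esub> ?s"
  from reidx_mono[OF this, of "(X \<^bold>\<times>\<^bsub>C\<^esub> A) \<^bold>\<times>\<^bsub>C\<^esub> B" "assoc_arrow C X A B"] show "?l \<sqsubseteq>\<^bsub>?L\<^esub> ?r"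
    using assms by (simp add: assoc_arrow_def Let_def)
qed

lemma assoc_arrow_in_hom [simp]:
  "\<lbrakk>A \<in> Ob C; B \<in> Ob C\<rbrakk>
    \<Longrightarrow> assoc_arrow C X A B \<in> Hom C ((X \<^bold>\<times>\<^bsub>C\<^esub> A) \<^bold>\<times>\<^bsub>C\<^esub> B) (X \<^bold>\<times>\<^bsub>C\<^esub> (A \<^bold>\<times>\<^bsub>C\<^esub> B))"
  by (simp add: assoc_arrow_def Let_def)

lemma kleisli_exq_le_iff:
  assumes "A \<in> Ob C" "B \<in> Ob C" "\<alpha> \<in> carrier (Fib P (X \<^bold>\<times>\<^bsub>C\<^esub> (A \<^bold>\<times>\<^bsub>C\<^esub> B)))"
    "\<beta> \<in> carrier (Fib P (X \<^bold>\<times>\<^bsub>C\<^esub> A))"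
  shows "kleisli_exq B A \<alpha> \<sqsubseteq>\<^bsub>Fib P (X \<^bold>\<times>\<^bsub>C\<^esub> A)\<^esub> \<beta> \<longleftrightarrow>
    \<alpha> \<sqsubseteq>\<^bsub>Fib P (X \<^bold>\<times>\<^bsub>C\<^esub> (A \<^bold>\<times>\<^bsub>C\<^esub> B))\<^esub> Reidx K (A \<^bold>\<times>\<^bsub>C\<^esub> B) A (Pr1 (Base K) A B) \<beta>"
  using reidx_assoc_le_iff[OF assms] assms by (simp add: kleisli_exq_def exq_le_iff)

lemma kleisli_is_exq:
  assumes A: "A \<in> Ob C" and B: "B \<in> Ob C"
  shows "is_exq K B A (kleisli_exq B A)"
proof -
  interpret K: is_doctrine K by (rule kleisli_is_doctrine)
  have closed: "kleisli_exq B A \<alpha> \<in> carrier (Fib K A)"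
    if "\<alpha> \<in> carrier (Fib K (A \<^bold>\<times>\<^bsub>C\<^esub> B))" for \<alpha>
    \<comment> \<open>The adjunction at \<open>bound A\<close>: the Kleisli projection reindexes it
      to the bound of \<open>A \<times> B\<close>, which is above \<alpha>.\<close>
    using that A B kleisli_exq_le_iff[OF A B, of \<alpha> "bound A"] by (simp add: kleisli_exq_def)
  show ?thesis unfolding is_exq_def
    using A B closed K.fib[of A] K.fib[of "A \<^bold>\<times>\<^bsub>C\<^esub> B"] K.reidx_closed[of "A \<^bold>\<times>\<^bsub>C\<^esub> B" A "Pr1 (Base K) A B"]
      kleisli_exq_le_iff[OF A B]
    by (intro galois_connection.intro connection.intro galois_connection_axioms.intro) auto
qed

lemma exq_kleisli:
  assumes "A \<in> Ob C" "B \<in> Ob C" "\<alpha> \<in> carrier (Fib K (A \<^bold>\<times>\<^bsub>C\<^esub> B))"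
  shows "exq K B A \<alpha> = kleisli_exq B A \<alpha>"
  using is_doctrine.exq_eq[OF kleisli_is_doctrine kleisli_is_exq] assms by simp

lemma kleisli_exq_closed:
  assumes "A \<in> Ob C" "B \<in> Ob C" "\<alpha> \<in> carrier (Fib K (A \<^bold>\<times>\<^bsub>C\<^esub> B))"
  shows "kleisli_exq B A \<alpha> \<in> carrier (Fib K A)"
  using galois_connection.axioms(1)[OF kleisli_is_exq[unfolded is_exq_def],
      THEN connection.lower_closed, of A B \<alpha>] assms by simp

text \<open>Up to the associativity isomorphisms, the lift of the Kleisli arrow
  \<open>f \<times> id\<close> is \<open><Pr1, f> \<times> id\<close> in \<open>C\<close>, so the
  square is one for \<open>P\<close>.\<close>

lemma kleisli_beck_chevalley:
  assumes A: "A \<in> Ob C" and A': "A' \<in> Ob C" and B: "B \<in> Ob C" and f: "f \<in> Hom (Base K) A A'"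
    and \<alpha>: "\<alpha> \<in> carrier (Fib K (A' \<^bold>\<times>\<^bsub>C\<^esub> B))"
  shows "kleisli_exq B A (Reidx K (A \<^bold>\<times>\<^bsub>C\<^esub> B) (A' \<^bold>\<times>\<^bsub>C\<^esub> B)
      (cross (Base K) A A' B B f (Id (Base K) B)) \<alpha>) =
    Reidx K A A' f (kleisli_exq B A' \<alpha>)"
proof -
  let ?f = "pair C (X \<^bold>\<times>\<^bsub>C\<^esub> A) X A' (Pr1 C X A) f"
  let ?\<alpha> = "Reidx P ((X \<^bold>\<times>\<^bsub>C\<^esub> A') \<^bold>\<times>\<^bsub>C\<^esub> B) (X \<^bold>\<times>\<^bsub>C\<^esub> (A' \<^bold>\<times>\<^bsub>C\<^esub> B)) (assoc_arrow C X A' B) \<alpha>"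
  have "exq P B (X \<^bold>\<times>\<^bsub>C\<^esub> A) (Reidx P ((X \<^bold>\<times>\<^bsub>C\<^esub> A) \<^bold>\<times>\<^bsub>C\<^esub> B) ((X \<^bold>\<times>\<^bsub>C\<^esub> A') \<^bold>\<times>\<^bsub>C\<^esub> B)
      (cross C (X \<^bold>\<times>\<^bsub>C\<^esub> A) (X \<^bold>\<times>\<^bsub>C\<^esub> A') B B ?f (Id C B)) ?\<alpha>) =
    Reidx P (X \<^bold>\<times>\<^bsub>C\<^esub> A) (X \<^bold>\<times>\<^bsub>C\<^esub> A') ?f (exq P B (X \<^bold>\<times>\<^bsub>C\<^esub> A') ?\<alpha>)"
    using assms by (intro beck_chevalley) simp_all
  then show ?thesis
    using assms by (simp add: kleisli_exq_def cross_def cart.kleisli_pair assoc_arrow_def Let_def)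
qed

text \<open>Reindexing along \<open>assoc_arrow\<close> preserves the meet and turns the Kleisli
  weakening of \<beta> into its weakening along \<open>Pr1\<close> in \<open>P\<close>.\<close>

lemma kleisli_frobenius:
  assumes A: "A \<in> Ob C" and B: "B \<in> Ob C"
    and \<alpha>: "\<alpha> \<in> carrier (Fib P (X \<^bold>\<times>\<^bsub>C\<^esub> (A \<^bold>\<times>\<^bsub>C\<^esub> B)))" and \<beta>: "\<beta> \<in> carrier (Fib P (X \<^bold>\<times>\<^bsub>C\<^esub> A))"
  shows "kleisli_exq B A (\<alpha> \<sqinter>\<^bsub>Fib P (X \<^bold>\<times>\<^bsub>C\<^esub> (A \<^bold>\<times>\<^bsub>C\<^esub> B))\<^esub> Reidx K (A \<^bold>\<times>\<^bsub>C\<^esub> B) A (Pr1 (Base K) A B) \<beta>) =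
    kleisli_exq B A \<alpha> \<sqinter>\<^bsub>Fib P (X \<^bold>\<times>\<^bsub>C\<^esub> A)\<^esub> \<beta>"
  using frobenius[of B "X \<^bold>\<times>\<^bsub>C\<^esub> A" _ \<beta>] assms
  by (simp add: kleisli_exq_def assoc_arrow_def Let_def)

lemma kleisli_is_existential: "existential_doctrine K"
proof -
  interpret K: primary_doctrine K by (rule kleisli_primary)
  show ?thesis
  proof
    show "\<exists>E. is_exq K B A E" if "B \<in> Ob (Base K)" "A \<in> Ob (Base K)" for A B
      using that kleisli_is_exq by auto
  next
    fix A A' B f \<alpha>
    assume *: "B \<in> Ob (Base K)" "A \<in> Ob (Base K)" "A' \<in> Ob (Base K)" "f \<in> Hom (Base K) A A'"
      "\<alpha> \<in> carrier (Fib K (A' \<^bold>\<times>\<^bsub>Base K\<^esub> B))"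
    \<comment> \<open>\<open>exq_kleisli\<close> applies only inside the carrier, so the reindexed
      \<alpha> must first be placed in the Kleisli fibre.\<close>
    have "cross (Base K) A A' B B f (Id (Base K) B) \<in> Hom (Base K) (A \<^bold>\<times>\<^bsub>Base K\<^esub> B) (A' \<^bold>\<times>\<^bsub>Base K\<^esub> B)"
      unfolding cross_def
      by (intro K.cart.pair_in_hom K.cart.comp_in_hom K.cart.prod_in_Ob K.cart.Pr1_in_hom
          K.cart.Pr2_in_hom K.cart.id_in_hom *)
    then have "Reidx K (A \<^bold>\<times>\<^bsub>Base K\<^esub> B) (A' \<^bold>\<times>\<^bsub>Base K\<^esub> B) (cross (Base K) A A' B B f (Id (Base K) B)) \<alpha>
        \<in> carrier (Fib K (A \<^bold>\<times>\<^bsub>Base K\<^esub> B))"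
      using * by (intro K.reidx_closed K.cart.prod_in_Ob)
    then show "exq K B A (Reidx K (A \<^bold>\<times>\<^bsub>Base K\<^esub> B) (A' \<^bold>\<times>\<^bsub>Base K\<^esub> B)
        (cross (Base K) A A' B B f (Id (Base K) B)) \<alpha>) = Reidx K A A' f (exq K B A' \<alpha>)"
      using * kleisli_beck_chevalley[of A A' B f \<alpha>] exq_kleisli[of A B] exq_kleisli[of A' B \<alpha>]
      by simp
  next
    fix A B \<alpha> \<beta>
    assume *: "B \<in> Ob (Base K)" "A \<in> Ob (Base K)" "\<alpha> \<in> carrier (Fib K (A \<^bold>\<times>\<^bsub>Base K\<^esub> B))"
      "\<beta> \<in> carrier (Fib K A)"
    let ?\<beta> = "Reidx K (A \<^bold>\<times>\<^bsub>Base K\<^esub> B) A (Pr1 (Base K) A B) \<beta>"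
    have \<beta>: "?\<beta> \<in> carrier (Fib K (A \<^bold>\<times>\<^bsub>Base K\<^esub> B))"
      using * by (intro K.reidx_closed K.cart.prod_in_Ob K.cart.Pr1_in_hom)
    have meet: "\<alpha> \<sqinter>\<^bsub>Fib K (A \<^bold>\<times>\<^bsub>Base K\<^esub> B)\<^esub> ?\<beta> = \<alpha> \<sqinter>\<^bsub>Fib P (X \<^bold>\<times>\<^bsub>C\<^esub> (A \<^bold>\<times>\<^bsub>C\<^esub> B))\<^esub> ?\<beta>"
      using * \<beta> by (simp add: fib_semilattice lower_semilattice.down_set_meet del: reidx_reidx)
    have "exq K B A (\<alpha> \<sqinter>\<^bsub>Fib K (A \<^bold>\<times>\<^bsub>Base K\<^esub> B)\<^esub> ?\<beta>) =
        kleisli_exq B A (\<alpha> \<sqinter>\<^bsub>Fib K (A \<^bold>\<times>\<^bsub>Base K\<^esub> B)\<^esub> ?\<beta>)"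
      using * \<beta> K.meet_closed[of "A \<^bold>\<times>\<^bsub>Base K\<^esub> B" \<alpha> ?\<beta>] by (intro exq_kleisli) simp_all
    also have "\<dots> = kleisli_exq B A \<alpha> \<sqinter>\<^bsub>Fib P (X \<^bold>\<times>\<^bsub>C\<^esub> A)\<^esub> \<beta>"
      unfolding meet
      using * kleisli_frobenius[of A B \<alpha> \<beta>] by simp
    also have "\<dots> = exq K B A \<alpha> \<sqinter>\<^bsub>Fib K A\<^esub> \<beta>"
      using * kleisli_exq_closed[of A B \<alpha>] exq_kleisli[of A B \<alpha>]
      by (simp add: fib_semilattice lower_semilattice.down_set_meet)
    finally show "exq K B A (\<alpha> \<sqinter>\<^bsub>Fib K (A \<^bold>\<times>\<^bsub>Base K\<^esub> B)\<^esub> ?\<beta>) = exq K B A \<alpha> \<sqinter>\<^bsub>Fib K A\<^esub> \<beta>" .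
  qed
qed

lemma kleisli_component_exq:
  assumes A: "A \<in> Ob C" and B: "B \<in> Ob C" and \<alpha>: "\<alpha> \<in> carrier (Fib P (A \<^bold>\<times>\<^bsub>C\<^esub> B))"
  shows "kleisli_component P X \<phi> A (exq P B A \<alpha>) =
    kleisli_exq B A (kleisli_component P X \<phi> (A \<^bold>\<times>\<^bsub>C\<^esub> B) \<alpha>)"
proof -
  let ?Q = "(X \<^bold>\<times>\<^bsub>C\<^esub> A) \<^bold>\<times>\<^bsub>C\<^esub> B"
  let ?\<alpha> = "Reidx P ?Q (A \<^bold>\<times>\<^bsub>C\<^esub> B) (cross C (X \<^bold>\<times>\<^bsub>C\<^esub> A) A B B (Pr2 C X A) (Id C B)) \<alpha>"
  let ?\<phi> = "Reidx P ?Q (X \<^bold>\<times>\<^bsub>C\<^esub> A) (Pr1 C (X \<^bold>\<times>\<^bsub>C\<^esub> A) B) (bound A)"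
  have cross: "cross C (X \<^bold>\<times>\<^bsub>C\<^esub> A) A B B (Pr2 C X A) (Id C B) \<in> Hom C ?Q (A \<^bold>\<times>\<^bsub>C\<^esub> B)"
    using A B by (simp add: cross_def)
  have "kleisli_component P X \<phi> A (exq P B A \<alpha>) =
      bound A \<sqinter>\<^bsub>Fib P (X \<^bold>\<times>\<^bsub>C\<^esub> A)\<^esub> exq P B (X \<^bold>\<times>\<^bsub>C\<^esub> A) ?\<alpha>"
    \<comment> \<open>Beck-Chevalley, read from right to left by simp on the expanded
      \<open>?\<alpha>\<close>, moves the reindexing along \<open>Pr2 C X A\<close> outside the
      quantifier.\<close>
    using assms by (simp add: kleisli_component_def Let_def beck_chevalley)
  also have "\<dots> = exq P B (X \<^bold>\<times>\<^bsub>C\<^esub> A) (?\<alpha> \<sqinter>\<^bsub>Fib P ?Q\<^esub> ?\<phi>)"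
    using frobenius[of B "X \<^bold>\<times>\<^bsub>C\<^esub> A" ?\<alpha> "bound A"] cross assms
    by (simp add: meet_comm[of _ "bound A"])
  \<comment> \<open>After \<open>assoc_arrow\<close>, the second projection is
    \<open>Pr2 \<times> id\<close> and the first is \<open>Pr1 Pr1\<close>, so the component
    reindexes to the meet of \<open>?\<phi>\<close> and \<open>?\<alpha>\<close>. Commutativity is
    needed because the component has the bound on the left, Frobenius on the right.\<close>
  also have "\<dots> = kleisli_exq B A (kleisli_component P X \<phi> (A \<^bold>\<times>\<^bsub>C\<^esub> B) \<alpha>)"
    using assms
    by (simp add: meet_comm[of _ _ ?\<phi>] kleisli_exq_def kleisli_component_def assoc_arrow_def
        cross_def Let_def meet_comm)
  finally show ?thesis .
qed

lemma kleisli_existential_hom: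
  "existential_hom P K (kleisli_functor C X) (kleisli_component P X \<phi>)"
proof -
  interpret K: existential_doctrine K by (rule kleisli_is_existential)
  interpret H: primary_hom P K "kleisli_functor C X" "kleisli_component P X \<phi>"
    by (rule kleisli_primary_hom)
  show ?thesis
  proof
    fix A B \<alpha> assume *: "B \<in> Ob C" "A \<in> Ob C" "\<alpha> \<in> carrier (Fib P (A \<^bold>\<times>\<^bsub>C\<^esub> B))"
    \<comment> \<open>With the comparison arrow an identity, the reindexing in the existential
      condition disappears.\<close>
    have "prod_iso C (Base K) (kleisli_functor C X) A B = Id (Base K) (A \<^bold>\<times>\<^bsub>C\<^esub> B)"
      using * by (simp add: cart.kleisli_prod_iso)
    moreover have "kleisli_component P X \<phi> (A \<^bold>\<times>\<^bsub>C\<^esub> B) \<alpha> \<in> carrier (Fib K (A \<^bold>\<times>\<^bsub>C\<^esub> B))"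
      using * by (intro kleisli_component_closed) simp_all
    moreover from this have "Reidx K (A \<^bold>\<times>\<^bsub>C\<^esub> B) (A \<^bold>\<times>\<^bsub>C\<^esub> B) (Id (Base K) (A \<^bold>\<times>\<^bsub>C\<^esub> B))
        (kleisli_component P X \<phi> (A \<^bold>\<times>\<^bsub>C\<^esub> B) \<alpha>) = kleisli_component P X \<phi> (A \<^bold>\<times>\<^bsub>C\<^esub> B) \<alpha>"
      using * by (intro K.reidx_id) simp_all
    ultimately show "kleisli_component P X \<phi> A (exq P B A \<alpha>) =
        exq K (FOb (kleisli_functor C X) B) (FOb (kleisli_functor C X) A)
          (Reidx K (FOb (kleisli_functor C X) A \<^bold>\<times>\<^bsub>Base K\<^esub> FOb (kleisli_functor C X) B)
            (FOb (kleisli_functor C X) (A \<^bold>\<times>\<^bsub>C\<^esub> B))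
            (prod_iso C (Base K) (kleisli_functor C X) A B)
            (kleisli_component P X \<phi> (A \<^bold>\<times>\<^bsub>C\<^esub> B) \<alpha>))"
      using * by (simp add: kleisli_component_exq exq_kleisli)
  qed
qed

end

theorem proposition5p5:
  fixes P :: "('o, 'a, 'p) doctrine" and X :: 'o and \<phi> :: 'p
  assumes "primary_doctrine P"
    and "X \<in> Ob (Base P)"
    and "\<phi> \<in> carrier (Fib P X)"
    and "existential_doctrine P"
  shows "existential_doctrine (kleisli_doctrine P X \<phi>) \<and>
    existential_hom P (kleisli_doctrine P X \<phi>)
      (kleisli_functor (Base P) X) (kleisli_component P X \<phi>)"
proof -
  interpret kleisli_existential P X \<phi>
    using assms
    by (intro kleisli_existential.intro kleisli_construction.intro kleisli_construction_axioms.intro)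
  show ?thesis using kleisli_is_existential kleisli_existential_hom by blast
qed

end
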